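(* Let $E(X)$ be the Köthe-Bochner space associated with a Banach function space $E$ on the complete probability measure space $(\Omega,\Sigma,\mu)$ and a Banach space $X$. Let $T$ be an operator (bounded linear operator) on $E(X)$. Then the following are equivalent: (i) $T$ is a multiplication operator, i.e. there is $a\in L^\infty(\mu)$ with $T(f)=af$ for all $f\in E(X)$. (iii) The equality $$T(a\langle f,x^{\ast}\rangle\overset{\rightarrow}{x})=a\langle T(f),x^{\ast}\rangle\overset{\rightarrow}{x}$$ holds for all $a\in L^\infty(\mu)$, $f\in E(X)$, $x\in X$ and $x^{\ast}\in X^{\ast}$.
   Context: Scalars are real. $(\Omega,\Sigma,\mu)$ is a complete probability measure space. A Banach function space $E$ here means: $E$ is an order ideal of $L^1(\mu)$, a Banach lattice under its own norm $\|\cdot\|_E$, with continuous embedding $E\subset L^1(\mu)$, and the constant function $1$ belongs to $E$ with $\|1\|_E=1$ (so $L^\infty(\mu)\subset E$). $L(\mu,X)$ denotes the space of (a.e. equivalence classes of) strongly measurable functions $f:\Omega\to X$, i.e. Borel measurable functions such that $f(\Omega\setminus A)$ is separable for some $A\in\Sigma$ with $\mu(A)=0$. For $f\in L(\mu,X)$, its norm function is $|f|_X(t)=\|f(t)\|$. The Köthe-Bochner space is $E(X)=\{f\in L(\mu,X): |f|_X\in E\}$ with norm $\|f\|_{E(X)}=\|\,|f|_X\|_E$; it is a Banach $L^\infty(\mu)$-module under pointwise multiplication. For $x\in X$, $\overset{\rightarrow}{x}$ is the constant function with value $x$. For $f\in E(X)$ and $x^\ast$ in the Banach dual $X^\ast$,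 $\langle f,x^\ast\rangle\in E$ is the function $t\mapsto\langle f(t),x^\ast\rangle$ (a.e.). For $\phi\in E$, $\phi\overset{\rightarrow}{x}\in E(X)$ is the function $t\mapsto\phi(t)x$. *)

theory Defs
  imports "HOL-Probability.Probability"
begin

text \<open>
  Elements of \<open>L\<^sup>\<infinity>\<close>, \<open>E\<close> and \<open>E(X)\<close> are a.e. equivalence classes of functions on \<open>space M\<close>. They are
  represented here by functions, the sets below being closed under a.e. equality within the
  respective class of measurable functions, and equality of classes is written out as
  a.e. equality.
\<close>

definition Linfty :: "'w measure \<Rightarrow> ('w \<Rightarrow> real) set" where
  "Linfty M = {a \<in> borel_measurable M. \<exists>C. AE t in M. \<bar>a t\<bar> \<le> C}"

text \<open>
  \<open>E\<close> is the set of (all representatives of) elements of the function space, and \<open>N\<close> its norm.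
  Invariance of \<open>E\<close> and \<open>N\<close> under a.e. equality is contained in the assumptions
  \<open>ideal\<close> and \<open>norm_mono\<close>.
\<close>

locale banach_function_space = prob_space M + complete_measure M
  for M :: "'w measure" +
  fixes E :: "('w \<Rightarrow> real) set" and N :: "('w \<Rightarrow> real) \<Rightarrow> real"
  assumes subset_L1: "\<And>f. f \<in> E \<Longrightarrow> integrable M f"
    and add_closed: "\<And>f g. f \<in> E \<Longrightarrow> g \<in> E \<Longrightarrow> (\<lambda>t. f t + g t) \<in> E"
    and scale_closed: "\<And>c f. f \<in> E \<Longrightarrow> (\<lambda>t. c * f t) \<in> E"
    and ideal: "\<And>f g. f \<in> E \<Longrightarrow> g \<in> borel_measurable M \<Longrightarrow>
                  (AE t in M. \<bar>g t\<bar> \<le> \<bar>f t\<bar>) \<Longrightarrow> g \<in> E"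
    and norm_zero_iff: "\<And>f. f \<in> E \<Longrightarrow> N f = 0 \<longleftrightarrow> (AE t in M. f t = 0)"
    and norm_triangle: "\<And>f g. f \<in> E \<Longrightarrow> g \<in> E \<Longrightarrow> N (\<lambda>t. f t + g t) \<le> N f + N g"
    and norm_scale: "\<And>c f. f \<in> E \<Longrightarrow> N (\<lambda>t. c * f t) = \<bar>c\<bar> * N f"
    and norm_mono: "\<And>f g. f \<in> E \<Longrightarrow> g \<in> E \<Longrightarrow> (AE t in M. \<bar>g t\<bar> \<le> \<bar>f t\<bar>) \<Longrightarrow> N g \<le> N f"
    and norm_complete: "\<And>u :: nat \<Rightarrow> 'w \<Rightarrow> real. (\<And>n. u n \<in> E) \<Longrightarrow>
           (\<forall>e>0. \<exists>n0. \<forall>m\<ge>n0. \<forall>n\<ge>n0. N (\<lambda>t. u m t - u n t) < e) \<Longrightarrow>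
           \<exists>f\<in>E. (\<lambda>n. N (\<lambda>t. u n t - f t)) \<longlonglongrightarrow> 0"
    and embedding: "\<exists>C. \<forall>f\<in>E. (\<integral>t. \<bar>f t\<bar> \<partial>M) \<le> C * N f"
    and one_mem: "(\<lambda>t. 1) \<in> E"
    and norm_one: "N (\<lambda>t. 1) = 1"

definition strongly_measurable :: "'w measure \<Rightarrow> ('w \<Rightarrow> 'x::banach) \<Rightarrow> bool" where
  "strongly_measurable M f \<longleftrightarrow>
     f \<in> borel_measurable M \<and>
     (\<exists>A\<in>null_sets M. separable_space (top_of_set (f ` (space M - A))))"

definition kothe_bochner :: "'w measure \<Rightarrow> ('w \<Rightarrow> real) set \<Rightarrow> ('w \<Rightarrow> 'x::banach) set" where
  "kothe_bochner M E = {f. strongly_measurable M f \<and> (\<lambda>t. norm (f t)) \<in> E}"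

definition kb_norm :: "(('w \<Rightarrow> real) \<Rightarrow> real) \<Rightarrow> ('w \<Rightarrow> 'x::banach) \<Rightarrow> real" where
  "kb_norm N f = N (\<lambda>t. norm (f t))"

text \<open>
  The first two conditions say that \<open>T\<close> induces a map of \<open>E(X)\<close>, as a space of classes, into itself.
\<close>

definition kb_operator ::
  "'w measure \<Rightarrow> ('w \<Rightarrow> real) set \<Rightarrow> (('w \<Rightarrow> real) \<Rightarrow> real) \<Rightarrow>
   (('w \<Rightarrow> 'x::banach) \<Rightarrow> ('w \<Rightarrow> 'x)) \<Rightarrow> bool" where
  "kb_operator M E N T \<longleftrightarrow>
     (\<forall>f\<in>kothe_bochner M E. T f \<in> kothe_bochner M E) \<and>
     (\<forall>f\<in>kothe_bochner M E. \<forall>g\<in>kothe_bochner M E.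
        (AE t in M. f t = g t) \<longrightarrow> (AE t in M. T f t = T g t)) \<and>
     (\<forall>f\<in>kothe_bochner M E. \<forall>g\<in>kothe_bochner M E.
        AE t in M. T (\<lambda>s. f s + g s) t = T f t + T g t) \<and>
     (\<forall>c. \<forall>f\<in>kothe_bochner M E. AE t in M. T (\<lambda>s. c *\<^sub>R f s) t = c *\<^sub>R T f t) \<and>
     (\<exists>C. \<forall>f\<in>kothe_bochner M E. kb_norm N (T f) \<le> C * kb_norm N f)"

definition multiplication_operator ::
  "'w measure \<Rightarrow> ('w \<Rightarrow> real) set \<Rightarrow> (('w \<Rightarrow> 'x::banach) \<Rightarrow> ('w \<Rightarrow> 'x)) \<Rightarrow> bool" where
  "multiplication_operator M E T \<longleftrightarrow>
     (\<exists>a\<in>Linfty M. \<forall>f\<in>kothe_bochner M E. AE t in M. T f t = a t *\<^sub>R f t)"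

end

theory Submission
  imports Defs
begin

text \<open>
  A multiplication operator satisfies the identity by a direct computation. Conversely, let
  \<open>T\<close> satisfy it. Fix a unit vector \<open>e\<close> and a functional \<open>e'\<close> with \<open>e' e = 1\<close>. The only candidate
  for the multiplier is \<open>h = e' \<circ> T e\<close>, where \<open>e\<close> also denotes the constant function. The identity
  for \<open>f = e\<close> gives \<open>T (\<phi> e) = h \<phi> e\<close> for every bounded \<open>\<phi>\<close>, and the boundedness of \<open>T\<close>, tested on
  the indicators of the sets where \<open>\<bar>h\<bar>\<close> is large, makes \<open>h\<close> essentially bounded
  (\<open>multiplier_bounded\<close>).

  For arbitrary \<open>f\<close> and \<open>x'\<close>, the multiplier \<open>a = 1 / (1 + \<bar>x' \<circ> f\<bar>)\<close> makes \<open>a (x' \<circ> f)\<close> bounded. The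
  identity therefore evaluates \<open>T (a (x' \<circ> f) e)\<close> in two ways, as \<open>h a (x' \<circ> f) e\<close> and as
  \<open>a (x' \<circ> T f) e\<close>, and division by \<open>a > 0\<close> gives \<open>x' \<circ> T f = h (x' \<circ> f)\<close> almost
  everywhere. The exceptional null set depends on \<open>x'\<close>; as \<open>f\<close> and \<open>T f\<close> have essentially separable range, countably many
  functionals suffice to conclude \<open>T f = h f\<close> almost everywhere (\<open>AE_eq_scaleR_if_functionals\<close>).

  Both \<open>e'\<close> and the countable separating families come from the Hahn-Banach theorem in the form of
  \<open>exists_norming_functional\<close>.
\<close>

section \<open>A Hahn-Banach theorem through minimal sublinear functionals\<close>

definition sublinear :: "('x::real_vector \<Rightarrow> real) \<Rightarrow> bool" where
  "sublinear p \<longleftrightarrow>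
     (\<forall>x y. p (x + y) \<le> p x + p y) \<and> (\<forall>c x. 0 \<le> c \<longrightarrow> p (c *\<^sub>R x) \<le> c * p x)"

lemma sublinear_add: "sublinear p \<Longrightarrow> p (x + y) \<le> p x + p y"
  by (simp add: sublinear_def)

lemma sublinear_scale_le: "sublinear p \<Longrightarrow> 0 \<le> c \<Longrightarrow> p (c *\<^sub>R x) \<le> c * p x"
  by (simp add: sublinear_def)

lemma sublinear_zero:
  assumes "sublinear p" shows "p 0 = 0"
  using sublinear_add[OF assms, of 0 0] sublinear_scale_le[OF assms, of 0 0] by simp

lemma sublinear_scale:
  assumes p: "sublinear p" and c: "0 \<le> c"
  shows "p (c *\<^sub>R x) = c * p x"
proof (cases "c = 0")
  case True
  then show ?thesis by (simp add: sublinear_zero[OF p])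
next
  case False
  with c have "c > 0" by simp
  then have "p ((1 / c) *\<^sub>R c *\<^sub>R x) \<le> (1 / c) * p (c *\<^sub>R x)"
    by (intro sublinear_scale_le[OF p]) simp
  then have "c * p x \<le> p (c *\<^sub>R x)" using \<open>c > 0\<close> by (simp add: field_simps)
  with sublinear_scale_le[OF p c, of x] show ?thesis by simp
qed

lemma sublinear_minus:
  assumes "sublinear p" shows "- p (- x) \<le> p x"
  using sublinear_add[OF assms, of x "- x"] by (simp add: sublinear_zero[OF assms])

lemma sublinear_norm: "sublinear (norm :: 'x::real_normed_vector \<Rightarrow> real)"
  by (auto simp: sublinear_def norm_triangle_ineq)

text \<open>
  The hypothesis \<open>add\<close> weakens directedness: it lets the infimum on the left be compared with
  independently chosen members on the right. It covers both a chain of sublinear functionals and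
  the one-parameter family in \<open>sublinear_lowering\<close>, whose members need not be sublinear themselves.
\<close>

lemma sublinear_INF:
  assumes ne: "I \<noteq> {}"
    and bdd: "\<And>x. bdd_below ((\<lambda>i. g i x) ` I)"
    and add: "\<And>i j x y. i \<in> I \<Longrightarrow> j \<in> I \<Longrightarrow> \<exists>k\<in>I. g k (x + y) \<le> g i x + g j y"
    and scale: "\<And>i c x. i \<in> I \<Longrightarrow> 0 \<le> c \<Longrightarrow> \<exists>k\<in>I. g k (c *\<^sub>R x) \<le> c * g i x"
  shows "sublinear (\<lambda>x. INF i\<in>I. g i x)"
proof -
  let ?u = "\<lambda>x. INF i\<in>I. g i x"
  have lower: "?u x \<le> g i x" if "i \<in> I" for i x
    using that bdd by (intro cINF_lower)
  have "?u (x + y) \<le> ?u x + ?u y" for x y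
  proof -
    have *: "?u (x + y) \<le> g i x + g j y" if "i \<in> I" "j \<in> I" for i j
      using add[OF that, of x y] lower by (meson order_trans)
    have "?u (x + y) - g j y \<le> ?u x" if "j \<in> I" for j
      using ne *[OF _ that] by (intro cINF_greatest) (auto simp: algebra_simps)
    then have "?u (x + y) - ?u x \<le> ?u y"
      using ne by (intro cINF_greatest) (auto simp: algebra_simps)
    then show ?thesis by simp
  qed
  moreover have "?u (c *\<^sub>R x) \<le> c * ?u x" if c: "0 \<le> c" for c x
  proof -
    have *: "?u (c *\<^sub>R x) \<le> c * g i x" if "i \<in> I" for i
      using scale[OF that c, of x] lower by (meson order_trans)
    show ?thesis
    proof (cases "c = 0")
      case True
      with * ne show ?thesis by auto
    next
      case False
      with c have "c > 0" by simp
      then have "?u (c *\<^sub>R x) / c \<le> ?u x"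
        using ne * by (intro cINF_greatest) (auto simp: field_simps)
      with \<open>c > 0\<close> show ?thesis by (simp add: field_simps)
    qed
  qed
  ultimately show ?thesis by (simp add: sublinear_def)
qed

text \<open>
  The functional \<open>q x = (INF t\<in>{0..}. p (x + t *\<^sub>R y) - t * p y)\<close> does the job; the value \<open>t = 1\<close> gives
  the last bound. The lemma has two uses. For a minimal \<open>p\<close> it forces \<open>p x + p y \<le> p (x + y)\<close>, and for
  \<open>p = norm\<close> it produces a starting point below which every linear functional norms \<open>y\<close>.
\<close>

lemma sublinear_lowering:
  assumes p: "sublinear p"
  obtains q where "sublinear q" "q \<le> p" "\<And>x. q x \<le> p (x + y) - p y"
proof -
  define g where "g t x = p (x + t *\<^sub>R y) - t * p y" for t x
  let ?q = "\<lambda>x. INF t\<in>{0..}. g t x"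
  have bdd: "bdd_below ((\<lambda>t. g t x) ` {0..})" for x
  proof (rule bdd_belowI2)
    fix t :: real assume "t \<in> {0..}"
    then show "- p (- x) \<le> g t x"
      using sublinear_add[OF p, of "x + t *\<^sub>R y" "- x"] sublinear_scale[OF p, of t y]
      by (simp add: g_def)
  qed
  have le: "?q x \<le> g t x" if "0 \<le> t" for t x
    using that bdd by (intro cINF_lower) auto
  show ?thesis
  proof
    show "sublinear ?q"
    proof (rule sublinear_INF[OF _ bdd])
      fix s t :: real and x z
      assume "s \<in> {0..}" "t \<in> {0..}"
      moreover have "g (s + t) (x + z) \<le> g s x + g t z"
        using sublinear_add[OF p, of "x + s *\<^sub>R y" "z + t *\<^sub>R y"]
        by (simp add: g_def algebra_simps)
      ultimately show "\<exists>k\<in>{0..}. g k (x + z) \<le> g s x + g t z"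
        by (intro bexI[of _ "s + t"]) auto
    next
      fix t c :: real and x
      assume "t \<in> {0..}" "0 \<le> c"
      moreover have "g (c * t) (c *\<^sub>R x) \<le> c * g t x"
        using sublinear_scale_le[OF p \<open>0 \<le> c\<close>, of "x + t *\<^sub>R y"]
        by (simp add: g_def algebra_simps)
      ultimately show "\<exists>k\<in>{0..}. g k (c *\<^sub>R x) \<le> c * g t x"
        by (intro bexI[of _ "c * t"]) auto
    qed auto
    show "?q \<le> p" using le[of 0] by (simp add: le_fun_def g_def)
    show "?q x \<le> p (x + y) - p y" for x using le[of 1 x] by (simp add: g_def)
  qed
qed

text \<open>
  Zorn's lemma for the reversed pointwise order: the pointwise infimum of a chain below \<open>p\<close> is finite
  because every sublinear \<open>q \<le> p\<close> satisfies \<open>- p (- x) \<le> - q (- x) \<le> q x\<close>.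
\<close>

lemma exists_minimal_sublinear:
  assumes p: "sublinear p"
  obtains q where "sublinear q" "q \<le> p" "\<And>r. sublinear r \<Longrightarrow> r \<le> q \<Longrightarrow> r = q"
proof -
  define A where "A = {q. sublinear q \<and> q \<le> p}"
  let ?R = "\<lambda>q r :: _ \<Rightarrow> real. r \<le> q"
  have "\<exists>m\<in>A. \<forall>a\<in>A. ?R m a \<longrightarrow> a = m"
  proof (rule predicate_Zorn)
    show "partial_order_on A (relation_of ?R A)"
      by (rule partial_order_on_relation_ofI) auto
  next
    fix C assume C: "C \<in> Chains (relation_of ?R A)"
    then have CA: "C \<subseteq> A" and chain: "\<And>q r. q \<in> C \<Longrightarrow> r \<in> C \<Longrightarrow> q \<le> r \<or> r \<le> q"
      by (auto simp: Chains_def relation_of_def)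
    show "\<exists>u\<in>A. \<forall>q\<in>C. u \<le> q"
    proof (cases "C = {}")
      case True
      with p show ?thesis by (auto simp: A_def)
    next
      case False
      let ?u = "\<lambda>x. INF q\<in>C. q x"
      have sub: "sublinear q" and le_p: "q x \<le> p x" if "q \<in> C" for q x
        using that CA by (auto simp: A_def le_fun_def)
      have bdd: "bdd_below ((\<lambda>q. q x) ` C)" for x
      proof (rule bdd_belowI2)
        fix q assume "q \<in> C"
        then show "- p (- x) \<le> q x"
          using sublinear_minus[OF sub, of q x] le_p[of q "- x"] by simp
      qed
      have lower: "?u x \<le> q x" if "q \<in> C" for q x
        using that bdd by (intro cINF_lower)
      have "sublinear ?u"
      proof (rule sublinear_INF[OF False bdd])
        fix q r x y assume "q \<in> C" "r \<in> C"
        then show "\<exists>k\<in>C. k (x + y) \<le> q x + r y"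
          using chain[of q r] sublinear_add[OF sub, of q x y] sublinear_add[OF sub, of r x y]
          by (auto simp: le_fun_def) (smt (verit))+
      next
        fix q c x assume "q \<in> C" "(0::real) \<le> c"
        then show "\<exists>k\<in>C. k (c *\<^sub>R x) \<le> c * q x"
          using sublinear_scale_le[OF sub] by blast
      qed
      moreover from False obtain q where "q \<in> C" by blast
      then have "?u \<le> p"
        using lower le_p by (intro le_funI) (meson order_trans)
      ultimately show ?thesis
        using lower by (intro bexI[of _ ?u]) (auto simp: A_def le_fun_def)
    qed
  qed
  then obtain q where "q \<in> A" and min: "\<And>r. r \<in> A \<Longrightarrow> r \<le> q \<Longrightarrow> r = q"
    by blast
  show ?thesis
  proof
    show "sublinear q" "q \<le> p" using \<open>q \<in> A\<close> by (auto simp: A_def)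
    show "r = q" if "sublinear r" "r \<le> q" for r
      using that \<open>q \<le> p\<close> by (intro min) (auto simp: A_def)
  qed
qed

lemma minimal_sublinear_linear:
  assumes q: "sublinear q" and min: "\<And>r. sublinear r \<Longrightarrow> r \<le> q \<Longrightarrow> r = q"
  shows "linear q"
proof -
  have add: "q (x + y) = q x + q y" for x y
  proof -
    obtain r where "sublinear r" "r \<le> q" and r: "\<And>x. r x \<le> q (x + y) - q y"
      using sublinear_lowering[OF q, of y] by metis
    with min have "r = q" by blast
    with r[of x] sublinear_add[OF q, of x y] show ?thesis by simp
  qed
  have minus: "q (- x) = - q x" for x
    using add[of x "- x"] by (simp add: sublinear_zero[OF q])
  have "q (c *\<^sub>R x) = c * q x" for c x
  proof (cases "0 \<le> c")
    case True
    then show ?thesis by (rule sublinear_scale[OF q])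
  next
    case False
    then have "q ((- c) *\<^sub>R (- x)) = - c * q (- x)" by (intro sublinear_scale[OF q]) simp
    then show ?thesis by (simp add: minus)
  qed
  with add show ?thesis by (intro linearI) auto
qed

text \<open>
  Lowering the norm in the direction \<open>x\<close> gives \<open>p \<le> norm\<close> with \<open>p (- x) \<le> - norm x\<close>. A minimal
  sublinear functional below \<open>p\<close> is linear, so its value at \<open>x\<close> is at least \<open>norm x\<close>.
\<close>

theorem exists_norming_functional:
  fixes x :: "'x::real_normed_vector"
  obtains x' :: "'x \<Rightarrow>\<^sub>L real" where
    "blinfun_apply x' x = norm x" "\<And>y. \<bar>blinfun_apply x' y\<bar> \<le> norm y"
proof -
  obtain p where p: "sublinear p" "p \<le> norm" and px: "\<And>y. p y \<le> norm (y + x) - norm x"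
    using sublinear_lowering[OF sublinear_norm, of x] by metis
  obtain q where q: "sublinear q" "q \<le> p" "\<And>r. sublinear r \<Longrightarrow> r \<le> q \<Longrightarrow> r = q"
    using exists_minimal_sublinear[OF p(1)] by metis
  have lin: "linear q" by (rule minimal_sublinear_linear[OF q(1,3)])
  have le: "q y \<le> norm y" for y
    using q(2) p(2) by (meson le_fun_def order_trans)
  have abs: "\<bar>q y\<bar> \<le> norm y" for y
    using le[of y] le[of "- y"] by (simp add: linear_neg[OF lin])
  have "q (- x) \<le> - norm x"
    using q(2) px[of "- x"] by (auto simp: le_fun_def intro: order_trans)
  then have qx: "q x = norm x"
    using le[of x] by (simp add: linear_neg[OF lin])
  have "bounded_linear q"
    using lin abs by (intro bounded_linear_intro[of _ 1]) (auto simp: linear_add linear_scale)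
  then have "blinfun_apply (Blinfun q) = q" by (rule bounded_linear_Blinfun_apply)
  with qx abs that show ?thesis by metis
qed

text \<open>
  The family consists of norming functionals of the points of \<open>D\<close>. If all of them vanish at
  \<open>y \<noteq> 0\<close>, a point \<open>d\<close> within \<open>norm y / 2\<close> of \<open>y\<close> has norm \<open>\<phi> d (d - y) \<le> norm (d - y)\<close>, too small
  for \<open>d\<close> to be that close to \<open>y\<close>.
\<close>

lemma countable_functionals_separate:
  fixes D :: "'x::real_normed_vector set"
  assumes "countable D"
  obtains F :: "('x \<Rightarrow>\<^sub>L real) set" where "countable F"
    "\<forall>y\<in>closure D. (\<forall>x'\<in>F. blinfun_apply x' y = 0) \<longrightarrow> y = 0"
proof -
  obtain \<phi> :: "'x \<Rightarrow> 'x \<Rightarrow>\<^sub>L real" where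
    \<phi>: "\<And>d. blinfun_apply (\<phi> d) d = norm d" "\<And>d y. \<bar>blinfun_apply (\<phi> d) y\<bar> \<le> norm y"
    using exists_norming_functional by metis
  show ?thesis
  proof
    show "countable (\<phi> ` D)" using assms by simp
    have "y = 0" if y: "y \<in> closure D" and zero: "\<forall>x'\<in>\<phi> ` D. blinfun_apply x' y = 0" for y
    proof (rule ccontr)
      assume "y \<noteq> 0"
      then obtain d where d: "d \<in> D" "dist d y < norm y / 2"
        using y unfolding closure_approachable by (meson half_gt_zero zero_less_norm_iff)
      have "norm d = blinfun_apply (\<phi> d) (d - y)"
        using zero d(1) by (simp add: blinfun.diff_right \<phi>(1))
      also have "\<dots> \<le> norm (d - y)" using \<phi>(2)[of d "d - y"] by simp
      finally have "norm d < norm y / 2" using d(2) by (simp add: dist_norm)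
      moreover have "norm y \<le> norm d + norm (d - y)"
        using norm_triangle_sub[of y d] by (simp add: norm_minus_commute)
      ultimately show False using d(2) by (simp add: dist_norm)
    qed
    then show "\<forall>y\<in>closure D. (\<forall>x'\<in>\<phi> ` D. blinfun_apply x' y = 0) \<longrightarrow> y = 0" by blast
  qed
qed

section \<open>Testing strongly measurable functions by functionals\<close>

lemma strongly_measurable_AE_closure:
  assumes "strongly_measurable M f"
  obtains D where "countable D" "AE t in M. f t \<in> closure D"
proof -
  obtain A where A: "A \<in> null_sets M" "separable_space (top_of_set (f ` (space M - A)))"
    using assms by (auto simp: strongly_measurable_def)
  then obtain D where D: "countable D"
    "top_of_set (f ` (space M - A)) closure_of D = f ` (space M - A)"
    by (auto simp: separable_space_def)
  then have "f ` (space M - A) \<subseteq> closure D"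
    using closure_of_subtopology_subset[of euclidean "f ` (space M - A)" D] by simp
  moreover have "AE t in M. t \<in> space M - A"
    using AE_not_in[OF A(1)] AE_space by eventually_elim auto
  ultimately have "AE t in M. f t \<in> closure D"
    by (elim eventually_mono) blast
  with D(1) that show ?thesis by blast
qed

text \<open>
  The scalar \<open>h t\<close> varies with \<open>t\<close>, so the differences \<open>g t - h t *\<^sub>R f t\<close> are approximated with
  rational scalars: this puts them in the closure of one countable set, on which countably many
  functionals decide whether they vanish.
\<close>

lemma AE_eq_scaleR_if_functionals:
  fixes f g :: "'w \<Rightarrow> 'x::banach" and h :: "'w \<Rightarrow> real"
  assumes "strongly_measurable M f" "strongly_measurable M g"
    and eq: "\<And>x' :: 'x \<Rightarrow>\<^sub>L real.
      AE t in M. blinfun_apply x' (g t) = h t * blinfun_apply x' (f t)"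
  shows "AE t in M. g t = h t *\<^sub>R f t"
proof -
  obtain D1 where D1: "countable D1" "AE t in M. f t \<in> closure D1"
    using strongly_measurable_AE_closure[OF assms(1)] .
  obtain D2 where D2: "countable D2" "AE t in M. g t \<in> closure D2"
    using strongly_measurable_AE_closure[OF assms(2)] .
  let ?k = "\<lambda>(z :: 'x, c :: real, y :: 'x). z - c *\<^sub>R y"
  let ?D = "?k ` (D2 \<times> \<rat> \<times> D1)"
  have "countable ?D"
    using D1(1) D2(1) by (intro countable_image countable_SIGMA countable_rat)
  then obtain F :: "('x \<Rightarrow>\<^sub>L real) set" where F: "countable F"
    "\<forall>y\<in>closure ?D. (\<forall>x'\<in>F. blinfun_apply x' y = 0) \<longrightarrow> y = 0"
    by (rule countable_functionals_separate) (rule that)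
  have "?k ` closure (D2 \<times> \<rat> \<times> D1) \<subseteq> closure ?D"
  proof (rule image_closure_subset)
    show "continuous_on (closure (D2 \<times> \<rat> \<times> D1)) ?k"
      unfolding case_prod_unfold by (intro continuous_intros)
  qed (simp_all add: closure_subset)
  moreover have "(z, c, y) \<in> closure (D2 \<times> \<rat> \<times> D1)"
    if "z \<in> closure D2" "y \<in> closure D1" for z y and c :: real
    using that by (simp add: closure_Times Rats_closure_real)
  ultimately have cl: "z - c *\<^sub>R y \<in> closure ?D"
    if "z \<in> closure D2" "y \<in> closure D1" for z y and c :: real
    using that by (metis (no_types, lifting) case_prod_conv image_subset_iff)
  have "AE t in M. \<forall>x'\<in>F. blinfun_apply x' (g t) = h t * blinfun_apply x' (f t)"
    using eq F(1) by (simp add: AE_ball_countable)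
  with D1(2) D2(2) show ?thesis
  proof eventually_elim
    case (elim t)
    have "\<forall>x'\<in>F. blinfun_apply x' (g t - h t *\<^sub>R f t) = 0"
      using elim by (simp add: blinfun.diff_right blinfun.scaleR_right)
    then have "g t - h t *\<^sub>R f t = 0"
      using F(2) cl elim by blast
    then show ?case by simp
  qed
qed

lemma borel_measurable_blinfun:
  assumes "f \<in> borel_measurable M"
  shows "(\<lambda>t. blinfun_apply x' (f t)) \<in> borel_measurable M"
  by (rule borel_measurable_continuous_on[OF _ assms]) (intro continuous_intros)

lemma strongly_measurable_scaleR_const:
  fixes x :: "'x::banach"
  assumes "\<phi> \<in> borel_measurable M"
  shows "strongly_measurable M (\<lambda>t. \<phi> t *\<^sub>R x)"
proof -
  have "(\<lambda>t. \<phi> t *\<^sub>R x) \<in> borel_measurable M"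
    by (rule borel_measurable_continuous_on[OF _ assms]) (intro continuous_intros)
  moreover have "separable_space (top_of_set (\<phi> ` space M))"
  proof -
    obtain D where D: "countable D" "D \<subseteq> \<phi> ` space M" "\<phi> ` space M \<subseteq> closure D"
      by (rule separable)
    then have "top_of_set (\<phi> ` space M) closure_of D = \<phi> ` space M"
      by (simp add: closure_of_subtopology_open Int_absorb2)
    with D(1,2) show ?thesis by (auto simp: separable_space_def)
  qed
  then have "separable_space (top_of_set ((\<lambda>r. r *\<^sub>R x) ` \<phi> ` space M))"
    by (rule separable_space_continuous_map_image[where f = "\<lambda>r. r *\<^sub>R x"])
      (auto intro!: continuous_intros)
  then have "separable_space (top_of_set ((\<lambda>t. \<phi> t *\<^sub>R x) ` (space M - {})))"
    by (simp add: image_image)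
  ultimately show ?thesis by (auto simp: strongly_measurable_def intro!: bexI[of _ "{}"])
qed

section \<open>Multiplication operators on Koethe-Bochner spaces\<close>

context banach_function_space
begin

lemma bounded_mem:
  assumes "a \<in> Linfty M" shows "a \<in> E"
proof -
  obtain C where C: "AE t in M. \<bar>a t\<bar> \<le> C" and a: "a \<in> borel_measurable M"
    using assms by (auto simp: Linfty_def)
  have "AE t in M. \<bar>a t\<bar> \<le> \<bar>C * 1\<bar>" using C by eventually_elim auto
  with ideal[OF scale_closed[OF one_mem] a] show ?thesis by simp
qed

lemma scaleR_const_mem:
  assumes "\<phi> \<in> E" shows "(\<lambda>t. \<phi> t *\<^sub>R x) \<in> kothe_bochner M E"
proof -
  have meas: "\<phi> \<in> borel_measurable M"
    using subset_L1[OF assms] by auto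
  have "(\<lambda>t. norm (\<phi> t *\<^sub>R x)) \<in> E"
    by (rule ideal[OF scale_closed[OF assms, of "norm x"]]) (use meas in \<open>auto simp: abs_mult\<close>)
  with strongly_measurable_scaleR_const[OF meas] show ?thesis by (simp add: kothe_bochner_def)
qed

lemma blinfun_mem:
  assumes f: "f \<in> kothe_bochner M E"
  shows "(\<lambda>t. blinfun_apply x' (f t)) \<in> E"
proof (rule ideal)
  show "(\<lambda>t. norm x' * norm (f t)) \<in> E"
    using f by (intro scale_closed) (simp add: kothe_bochner_def)
  show "(\<lambda>t. blinfun_apply x' (f t)) \<in> borel_measurable M"
    using f by (intro borel_measurable_blinfun) (simp add: kothe_bochner_def strongly_measurable_def)
  show "AE t in M. \<bar>blinfun_apply x' (f t)\<bar> \<le> \<bar>norm x' * norm (f t)\<bar>"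
    using norm_blinfun[of x'] by auto
qed

lemma Linfty_mult_mem:
  assumes a: "a \<in> Linfty M" and \<phi>: "\<phi> \<in> E"
  shows "(\<lambda>t. a t * \<phi> t) \<in> E"
proof -
  obtain C where C: "AE t in M. \<bar>a t\<bar> \<le> C" and meas: "a \<in> borel_measurable M"
    using a by (auto simp: Linfty_def)
  show ?thesis
  proof (rule ideal[OF scale_closed[OF \<phi>, of C]])
    show "(\<lambda>t. a t * \<phi> t) \<in> borel_measurable M"
      using meas subset_L1[OF \<phi>] by auto
    show "AE t in M. \<bar>a t * \<phi> t\<bar> \<le> \<bar>C * \<phi> t\<bar>"
      using C by eventually_elim (auto simp: abs_mult intro!: mult_right_mono)
  qed
qed

text \<open>
  With \<open>K > C\<close> and \<open>A = {t. K < \<bar>h t\<bar>}\<close>, testing \<open>T\<close> on the indicator of \<open>A\<close> yields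
  \<open>K * N (indicat_real A) \<le> C * N (indicat_real A)\<close>, which forces \<open>A\<close> to be null.
\<close>

lemma multiplier_bounded:
  fixes T :: "('w \<Rightarrow> 'x::banach) \<Rightarrow> 'w \<Rightarrow> 'x"
  assumes T: "kb_operator M E N T" and e: "norm e = 1"
    and h: "h \<in> borel_measurable M"
    and mult: "\<And>\<phi>. \<phi> \<in> Linfty M \<Longrightarrow> AE t in M. T (\<lambda>s. \<phi> s *\<^sub>R e) t = (h t * \<phi> t) *\<^sub>R e"
  shows "h \<in> Linfty M"
proof -
  obtain C where C: "\<And>f. f \<in> kothe_bochner M E \<Longrightarrow> kb_norm N (T f) \<le> C * kb_norm N f"
    using T unfolding kb_operator_def by blast
  \<comment> \<open>\<open>C\<close> may be negative, and \<open>K\<close> has to be positive for \<open>K\<close> times the indicator to be dominated by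
    the image of \<open>?f\<close> in absolute value.\<close>
  define K where "K = max C 0 + 1"
  define A where "A = {t \<in> space M. K < \<bar>h t\<bar>}"
  have A: "A \<in> sets M" unfolding A_def using h by measurable
  have ind: "indicat_real A \<in> Linfty M"
    using A by (auto simp: Linfty_def indicator_def intro!: exI[of _ 1])
  let ?f = "\<lambda>s. indicat_real A s *\<^sub>R e"
  let ?g = "\<lambda>t. norm (T ?f t)"
  have f: "?f \<in> kothe_bochner M E" by (intro scaleR_const_mem bounded_mem ind)
  then have "T ?f \<in> kothe_bochner M E" using T unfolding kb_operator_def by blast
  then have g: "?g \<in> E" by (simp add: kothe_bochner_def)
  have "AE t in M. \<bar>K * indicat_real A t\<bar> \<le> \<bar>?g t\<bar>"
    using mult[OF ind] by eventually_elim (auto simp: A_def K_def indicator_def e)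
  then have "N (\<lambda>t. K * indicat_real A t) \<le> N ?g"
    by (intro norm_mono g scale_closed bounded_mem ind)
  also have "\<dots> \<le> C * N (indicat_real A)"
    using C[OF f] by (simp add: kb_norm_def e)
  finally have "(K - C) * N (indicat_real A) \<le> 0"
    using norm_scale[OF bounded_mem[OF ind], of K] by (simp add: K_def algebra_simps)
  moreover have "0 < K - C" by (simp add: K_def)
  ultimately have "N (indicat_real A) \<le> 0" by (simp add: mult_le_0_iff)
  moreover have "0 \<le> N (indicat_real A)"
  proof -
    have zero: "(\<lambda>t. 0 * indicat_real A t) \<in> E" by (intro scale_closed bounded_mem ind)
    have "N (\<lambda>t. 0 * indicat_real A t) \<le> N (indicat_real A)"
      by (intro norm_mono bounded_mem ind zero) auto
    then show ?thesis using norm_scale[OF bounded_mem[OF ind], of 0] by simp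
  qed
  ultimately have "AE t in M. indicat_real A t = 0"
    using norm_zero_iff[OF bounded_mem[OF ind]] by simp
  with AE_space have "AE t in M. \<bar>h t\<bar> \<le> K"
    by eventually_elim (auto simp: A_def indicator_def split: if_splits)
  with h show ?thesis by (auto simp: Linfty_def)
qed

end

lemma multiplication_operator_commutes:
  assumes "banach_function_space M E N" and "multiplication_operator M E T"
    and b: "b \<in> Linfty M" and f: "f \<in> kothe_bochner M E"
  shows "AE t in M. T (\<lambda>s. (b s * blinfun_apply x' (f s)) *\<^sub>R x) t
                  = (b t * blinfun_apply x' (T f t)) *\<^sub>R x"
proof -
  interpret banach_function_space M E N by fact
  obtain a where a: "\<And>f. f \<in> kothe_bochner M E \<Longrightarrow> AE t in M. T f t = a t *\<^sub>R f t"
    using assms(2) by (auto simp: multiplication_operator_def)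
  have "(\<lambda>s. (b s * blinfun_apply x' (f s)) *\<^sub>R x) \<in> kothe_bochner M E"
    by (intro scaleR_const_mem Linfty_mult_mem blinfun_mem b f)
  from a[OF this] a[OF f] show ?thesis
    by eventually_elim (simp add: blinfun.scaleR_right)
qed

lemma commuting_imp_multiplication_operator:
  fixes T :: "('w \<Rightarrow> 'x::banach) \<Rightarrow> 'w \<Rightarrow> 'x"
  assumes "banach_function_space M E N" and T: "kb_operator M E N T"
    and comm: "\<And>a f (x :: 'x) (x' :: 'x \<Rightarrow>\<^sub>L real). a \<in> Linfty M \<Longrightarrow> f \<in> kothe_bochner M E \<Longrightarrow>
      AE t in M. T (\<lambda>s. (a s * blinfun_apply x' (f s)) *\<^sub>R x) t
                  = (a t * blinfun_apply x' (T f t)) *\<^sub>R x"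
  shows "multiplication_operator M E T"
proof (cases "\<exists>x :: 'x. x \<noteq> 0")
  \<comment> \<open>In the zero space there is no unit vector, and every \<open>T\<close> is multiplication by \<open>0\<close>.\<close>
  case False
  then have "(u :: 'x) = v" for u v by metis
  then show ?thesis
    unfolding multiplication_operator_def
    by (intro bexI[of _ "\<lambda>_. 0"] ballI AE_I2) (auto simp: Linfty_def)
next
  case True
  interpret banach_function_space M E N by fact
  from True obtain x1 :: 'x where "x1 \<noteq> 0" by blast
  then obtain e :: 'x where e: "norm e = 1" by (metis norm_sgn)
  then obtain e' :: "'x \<Rightarrow>\<^sub>L real" where e': "blinfun_apply e' e = 1"
    using exists_norming_functional[of e] by metis
  have T_mem: "T f \<in> kothe_bochner M E" if "f \<in> kothe_bochner M E" for f
    using T that unfolding kb_operator_def by blast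
  have sm: "strongly_measurable M f" if "f \<in> kothe_bochner M E" for f :: "'w \<Rightarrow> 'x"
    using that by (simp add: kothe_bochner_def)
  have const: "(\<lambda>_. e) \<in> kothe_bochner M E"
    using scaleR_const_mem[OF one_mem, of e] by simp
  define h where "h = (\<lambda>t. blinfun_apply e' (T (\<lambda>_. e) t))"
  have h_meas: "h \<in> borel_measurable M"
    unfolding h_def using subset_L1[OF blinfun_mem[OF T_mem[OF const]]] by auto
  have T_e: "AE t in M. T (\<lambda>s. \<phi> s *\<^sub>R e) t = (h t * \<phi> t) *\<^sub>R e" if "\<phi> \<in> Linfty M" for \<phi>
    using comm[OF that const, of e' e] by (simp add: e' h_def mult.commute)
  have "h \<in> Linfty M" by (rule multiplier_bounded[OF T e h_meas T_e])
  moreover have "AE t in M. T f t = h t *\<^sub>R f t" if f: "f \<in> kothe_bochner M E" for f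
  proof (rule AE_eq_scaleR_if_functionals[OF sm[OF f] sm[OF T_mem[OF f]]])
    fix x' :: "'x \<Rightarrow>\<^sub>L real"
    \<comment> \<open>\<open>w\<close> lies in \<open>E\<close> but need not be bounded; the strictly positive \<open>a\<close> brings it within the reach
      of \<open>T_e\<close> and can be cancelled afterwards.\<close>
    define w where "w t = blinfun_apply x' (f t)" for t
    define a where "a t = 1 / (1 + \<bar>w t\<bar>)" for t
    have w: "w \<in> borel_measurable M"
      unfolding w_def using subset_L1[OF blinfun_mem[OF f]] by auto
    have a_pos: "a t > 0" for t by (simp add: a_def add_pos_nonneg)
    have a: "a \<in> Linfty M"
      using w by (auto simp: Linfty_def a_def[abs_def] divide_simps intro!: exI[of _ 1] AE_I2)
    have aw: "(\<lambda>t. a t * w t) \<in> Linfty M"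
      using w by (auto simp: Linfty_def a_def[abs_def] abs_mult divide_simps intro!: exI[of _ 1] AE_I2)
    from comm[OF a f, of x' e] T_e[OF aw]
    show "AE t in M. blinfun_apply x' (T f t) = h t * blinfun_apply x' (f t)"
    proof eventually_elim
      case (elim t)
      then have "(a t * blinfun_apply x' (T f t)) *\<^sub>R e = (h t * (a t * w t)) *\<^sub>R e"
        by (simp add: w_def)
      then have "a t * blinfun_apply x' (T f t) = a t * (h t * w t)"
        using e by auto
      then show ?case using a_pos[of t] by (simp add: w_def)
    qed
  qed
  ultimately show ?thesis by (auto simp: multiplication_operator_def)
qed

theorem corollary12:
  fixes M :: "'w measure"
    and E :: "('w \<Rightarrow> real) set"
    and N :: "('w \<Rightarrow> real) \<Rightarrow> real"
    and T :: "('w \<Rightarrow> 'x::banach) \<Rightarrow> ('w \<Rightarrow> 'x)"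
  assumes "banach_function_space M E N"
    and "kb_operator M E N T"
  shows "multiplication_operator M E T \<longleftrightarrow>
    (\<forall>a\<in>Linfty M. \<forall>f\<in>kothe_bochner M E. \<forall>x :: 'x. \<forall>x' :: 'x \<Rightarrow>\<^sub>L real.
       AE t in M. T (\<lambda>s. (a s * blinfun_apply x' (f s)) *\<^sub>R x) t
                  = (a t * blinfun_apply x' (T f t)) *\<^sub>R x)"
  using multiplication_operator_commutes[OF assms(1)]
    commuting_imp_multiplication_operator[OF assms] by blast

end
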